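(* Let $J\in\mathbb{N}$, $J\ge 1$, let $h=1/J$, and let $\mathbb{V}_h$ be the space of continuous functions on $[0,1]$ that vanish at $0$ and $1$ and are affine on each interval $[(j-1)h,jh]$, $j=1,\dots,J$. Let $\Delta_h:\mathbb{V}_h\to\mathbb{V}_h$ be the mass-lumped discrete Laplace operator, i.e. for $v_h\in\mathbb{V}_h$, $\Delta_h v_h$ is the unique element of $\mathbb{V}_h$ such that $$h\sum_{j=1}^{J-1}(\Delta_h v_h)(jh)\,w_h(jh) = -\int_0^1 \partial_x v_h\,\partial_x w_h\,\mathrm{d}x\qquad\text{for all } w_h\in\mathbb{V}_h.$$ Then for every $v_h\in\mathbb{V}_h$ and every $\varepsilon>0$, $$\int_0^1 \frac{\partial_x v_h}{\sqrt{|\partial_x v_h|^2+\varepsilon^2}}\;\partial_x\big(-\Delta_h v_h\big)\,\mathrm{d}x\;\ge\;0.$$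
   Context: The spatial domain is $\mathcal{O}=(0,1)$ (dimension $d=1$), with the uniform partition into subintervals $T_j=(x_{j-1},x_j)$, $x_j=jh$, $j=0,\dots,J$, $h=1/J$. $\mathbb{V}_h\subset \mathbb{H}^1_0(0,1)$ is the finite element space of globally continuous functions that are affine on each $T_j$ (and vanish at $0$ and $1$). For $v\in\mathbb{V}_h$, $\partial_x v$ denotes the weak derivative, which is constant on each $T_j$. The discrete (mass-lumped) inner product on $\mathbb{V}_h$ is $(\phi,\psi)_h=\int_0^1\mathcal{I}_h(\phi\psi)\,\mathrm{d}x=h\sum_{j=1}^{J-1}\phi(x_j)\psi(x_j)$, where $\mathcal{I}_h\Phi$ is the continuous function that is affine on each $T_j$ and equals $\Phi$ at the nodes $x_0,\dots,x_J$; the operator $\Delta_h$ is defined by $(\Delta_h v_h,w_h)_h=-(\partial_x v_h,\partial_x w_h)_{L^2(0,1)}$ for all $w_h\in\mathbb{V}_h$. *)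

theory Defs
  imports "HOL-Analysis.Analysis"
begin

text \<open>Weak derivatives on an open set \<open>U\<close> of the real line. As is usual in one dimension, the
  test functions are the \<open>C\<^sup>1\<close> functions with compact support in \<open>U\<close>; this yields the same weak
  derivatives as smooth test functions.\<close>

definition test_function :: "real set \<Rightarrow> (real \<Rightarrow> real) \<Rightarrow> bool" where
  "test_function U \<phi> \<longleftrightarrow>
     \<phi> C1_differentiable_on UNIV \<and> compact (closure {x. \<phi> x \<noteq> 0}) \<and> closure {x. \<phi> x \<noteq> 0} \<subseteq> U"

definition locally_integrable :: "real set \<Rightarrow> (real \<Rightarrow> real) \<Rightarrow> bool" where
  "locally_integrable U f \<longleftrightarrow> (\<forall>K. compact K \<and> K \<subseteq> U \<longrightarrow> set_integrable lborel K f)"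

definition is_weak_derivative :: "real set \<Rightarrow> (real \<Rightarrow> real) \<Rightarrow> (real \<Rightarrow> real) \<Rightarrow> bool" where
  "is_weak_derivative U v g \<longleftrightarrow>
     locally_integrable U v \<and> locally_integrable U g \<and>
     (\<forall>\<phi>. test_function U \<phi> \<longrightarrow>
        (LINT x:U|lborel. v x * deriv \<phi> x) = - (LINT x:U|lborel. g x * \<phi> x))"

text \<open>A weak derivative is determined only up to null sets; \<open>weak_dx v\<close> is an arbitrary
  representative on \<open>(0,1)\<close>, and is only ever used under integrals over \<open>(0,1)\<close>.\<close>

definition weak_dx :: "(real \<Rightarrow> real) \<Rightarrow> real \<Rightarrow> real" where
  "weak_dx v = (SOME g. is_weak_derivative {0<..<1} v g)"

definition mesh_width :: "nat \<Rightarrow> real" where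
  "mesh_width J = 1 / real J"

text \<open>Elements of the finite element space are functions on \<open>[0,1]\<close>. They are represented by their
  extension by zero to the real line, so that equality of functions is equality on \<open>[0,1]\<close> and
  the unique description in \<open>discrete_laplacian\<close> makes sense.\<close>

definition fe_space :: "nat \<Rightarrow> (real \<Rightarrow> real) set" where
  "fe_space J = {v. continuous_on {0..1} v \<and> v 0 = 0 \<and> v 1 = 0 \<and>
     (\<forall>j\<in>{1..J}. \<exists>a b. \<forall>x\<in>{(real j - 1) * mesh_width J .. real j * mesh_width J}. v x = a + b * x) \<and>
     (\<forall>x. x \<notin> {0..1} \<longrightarrow> v x = 0)}"

definition lumped_inner :: "nat \<Rightarrow> (real \<Rightarrow> real) \<Rightarrow> (real \<Rightarrow> real) \<Rightarrow> real" where
  "lumped_inner J \<phi> \<psi> =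
     mesh_width J * (\<Sum>j=1..J-1. \<phi> (real j * mesh_width J) * \<psi> (real j * mesh_width J))"

definition discrete_laplacian :: "nat \<Rightarrow> (real \<Rightarrow> real) \<Rightarrow> (real \<Rightarrow> real)" where
  "discrete_laplacian J v = (THE z. z \<in> fe_space J \<and>
     (\<forall>w\<in>fe_space J.
        lumped_inner J z w = - (LINT x:{0<..<1}|lborel. weak_dx v x * weak_dx w x)))"

end

theory Submission
  imports Defs
begin

text \<open>
Write \<open>s\<^sub>j\<close> for the slope of \<open>v\<close> on the \<open>j\<close>-th cell and \<open>F s = s / sqrt (s\<^sup>2 + \<epsilon>\<^sup>2)\<close>. In one space
dimension the mass-lumped Laplacian is the second difference: its value at the interior node \<open>j\<close> is
\<open>z\<^sub>j = (s\<^bsub>j+1\<^esub> - s\<^sub>j) / h\<close> (\<open>discrete_laplacian_nodes\<close>). As all weak derivatives are constant on cells,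
the integral in question is \<open>- \<Sum>\<^sub>j F s\<^sub>j (z\<^sub>j - z\<^bsub>j-1\<^esub>)\<close> with \<open>z\<^sub>0 = z\<^sub>J = 0\<close>, and summation by parts
turns it into \<open>\<Sum>\<^sub>j (F s\<^bsub>j+1\<^esub> - F s\<^sub>j) (s\<^bsub>j+1\<^esub> - s\<^sub>j) / h\<close> over the interior nodes. Every term is
nonnegative because \<open>F\<close> is increasing. The same
argument applies to any monotone \<open>F\<close> (\<open>mono_flux_discrete_laplacian_nonneg\<close>).

The analytic work lies in replacing \<open>weak_dx\<close>, an arbitrarily chosen representative, by the step
function of slopes (\<open>integral_weak_dx\<close>). This takes the existence of the weak derivative of a
piecewise affine function (\<open>fe_space_weak_derivative\<close>) and the uniqueness of weak derivatives almost
everywhere (\<open>weak_derivative_unique\<close>), which rests on the fundamental lemma of the calculus of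
variations for locally integrable functions.
\<close>

section \<open>Uniqueness of weak derivatives\<close>

text \<open>With \<open>q = max 0 ((x - a) (b - x))\<close>, the square \<open>q\<^sup>2\<close> is \<open>C\<^sup>1\<close> because it vanishes to second order at
\<open>a\<close> and \<open>b\<close>. On subintervals of \<open>[0,1]\<close> it takes values in \<open>[0,1]\<close> and is positive exactly on
\<open>(a,b)\<close>, so \<open>(1 - q\<^sup>2)\<^sup>n\<close> tends to the indicator of the complement of \<open>(a,b)\<close>. The functions below
are thus explicit \<open>C\<^sup>1\<close> test functions that approximate the indicator of \<open>(a,b)\<close>, without any
mollification.\<close>

definition bump :: "real \<Rightarrow> real \<Rightarrow> nat \<Rightarrow> real \<Rightarrow> real" where
  "bump a b n x = 1 - (1 - (max 0 ((x - a) * (b - x)))\<^sup>2) ^ n"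

lemma DERIV_max_0_square:
  "((\<lambda>t::real. (max 0 t)\<^sup>2) has_real_derivative 2 * max 0 t) (at t)"
proof (cases "t = 0")
  case True
  have "((\<lambda>y::real. ((max 0 y)\<^sup>2 - (max 0 0)\<^sup>2) / (y - 0)) \<longlongrightarrow> 0) (at 0)"
  proof (rule Lim_null_comparison)
    show "\<forall>\<^sub>F y::real in at 0. norm (((max 0 y)\<^sup>2 - (max 0 0)\<^sup>2) / (y - 0)) \<le> \<bar>y\<bar>"
      by (rule always_eventually) (auto simp: max_def power2_eq_square abs_mult)
    show "((\<lambda>y::real. \<bar>y\<bar>) \<longlongrightarrow> 0) (at 0)"
      by (auto intro!: tendsto_eq_intros)
  qed
  then show ?thesis
    using True by (simp add: has_field_derivative_iff)
next
  case False
  consider "t > 0" | "t < 0" using False by linarith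
  then show ?thesis
  proof cases
    case 1
    have "((\<lambda>t::real. t\<^sup>2) has_real_derivative 2 * max 0 t) (at t)"
      using 1 by (auto intro!: derivative_eq_intros)
    then show ?thesis
      by (rule has_field_derivative_transform_within[where d = t])
        (use 1 in \<open>auto simp: dist_real_def max_def\<close>)
  next
    case 2
    have "((\<lambda>t::real. 0) has_real_derivative 2 * max 0 t) (at t)"
      using 2 by (auto intro!: derivative_eq_intros)
    then show ?thesis
      by (rule has_field_derivative_transform_within[where d = "-t"])
        (use 2 in \<open>auto simp: dist_real_def max_def\<close>)
  qed
qed

lemma bump_eq_0: "x \<notin> {a<..<b} \<Longrightarrow> a \<le> b \<Longrightarrow> bump a b n x = 0"
proof -
  assume "x \<notin> {a<..<b}" "a \<le> b"
  then have "(x - a) * (b - x) \<le> 0"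
    by (auto simp: mult_le_0_iff not_less)
  then show ?thesis by (simp add: bump_def)
qed

lemma test_function_bump:
  assumes "a \<le> b" "{a..b} \<subseteq> U"
  shows "test_function U (bump a b n)"
proof -
  let ?q = "\<lambda>x. (x - a) * (b - x)"
  let ?D = "\<lambda>x. - (real n * (1 - (max 0 (?q x))\<^sup>2) ^ (n - 1) * - (2 * max 0 (?q x) * (a + b - 2 * x)))"
  have "((\<lambda>x. bump a b n x) has_real_derivative ?D x) (at x)" for x
  proof -
    have "(?q has_real_derivative (a + b - 2 * x)) (at x)"
      by (auto intro!: derivative_eq_intros)
    have "((\<lambda>x. 1 - (max 0 (?q x))\<^sup>2) has_real_derivative
        0 - 2 * max 0 (?q x) * (a + b - 2 * x)) (at x)"
      by (rule DERIV_diff[OF DERIV_const DERIV_chain2[OF DERIV_max_0_square]]) fact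
    from DERIV_power[OF this, of n]
    have "((\<lambda>x. 1 - (1 - (max 0 (?q x))\<^sup>2) ^ n) has_real_derivative
        0 - real n * ((0 - 2 * max 0 (?q x) * (a + b - 2 * x)) * (1 - (max 0 (?q x))\<^sup>2) ^ (n - Suc 0))) (at x)"
      by (rule DERIV_diff[OF DERIV_const])
    then show ?thesis
      unfolding bump_def by (rule DERIV_cong) simp
  qed
  then have C1: "bump a b n C1_differentiable_on UNIV"
    unfolding C1_differentiable_on_def
    by (intro exI[of _ ?D]) (auto simp: has_real_derivative_iff_has_vector_derivative
        intro!: continuous_intros)
  have sub: "closure {x. bump a b n x \<noteq> 0} \<subseteq> {a..b}"
  proof (intro closure_minimal subsetI)
    fix x assume "x \<in> {x. bump a b n x \<noteq> 0}"
    then have "x \<in> {a<..<b}" using bump_eq_0[OF _ assms(1)] by blast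
    then show "x \<in> {a..b}" by simp
  qed simp
  then have "compact (closure {x. bump a b n x \<noteq> 0})"
    by (meson bounded_closed_interval bounded_subset closed_closure compact_eq_bounded_closed)
  then show ?thesis
    using C1 sub assms(2) by (auto simp: test_function_def)
qed

lemma bump_01:
  assumes "0 \<le> a" "a \<le> b" "b \<le> 1"
  shows "0 \<le> bump a b n x" "bump a b n x \<le> 1"
proof -
  have "(max 0 ((x - a) * (b - x))) \<le> 1"
  proof (cases "x \<in> {a..b}")
    case True
    then have "(x - a) * (b - x) \<le> 1 * 1"
      using assms by (intro mult_mono) auto
    then show ?thesis by simp
  next
    case False
    then have "(x - a) * (b - x) \<le> 0"
      using assms by (auto simp: mult_le_0_iff)
    then show ?thesis by simp
  qed
  then have "(max 0 ((x - a) * (b - x)))\<^sup>2 \<le> 1"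
    by (simp add: power_le_one)
  then show "0 \<le> bump a b n x" "bump a b n x \<le> 1"
    by (auto simp: bump_def power_le_one)
qed

lemma bump_tendsto_1:
  assumes "0 \<le> a" "b \<le> 1" "a < x" "x < b"
  shows "(\<lambda>n. bump a b n x) \<longlonglongrightarrow> 1"
proof -
  have pos: "0 < (x - a) * (b - x)" using assms by simp
  have "(x - a) * (b - x) \<le> 1 * 1"
    using assms by (intro mult_mono) auto
  with pos have "0 < ((x - a) * (b - x))\<^sup>2" "((x - a) * (b - x))\<^sup>2 \<le> 1"
    by (auto simp: power_le_one)
  then have "(\<lambda>n. (1 - ((x - a) * (b - x))\<^sup>2) ^ n) \<longlonglongrightarrow> 0"
    by (intro LIMSEQ_realpow_zero) auto
  from tendsto_diff[OF tendsto_const[of 1] this] show ?thesis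
    using pos by (simp add: bump_def max_def)
qed

lemma borel_measurable_bump [measurable]: "bump a b n \<in> borel_measurable borel"
  unfolding bump_def by measurable

lemma locally_integrable_Icc:
  assumes "locally_integrable {0<..<1} f" "0 < a" "b < 1"
  shows "set_integrable lborel {a..b} f"
proof -
  have "compact {a..b} \<and> {a..b} \<subseteq> {0<..<1}" using assms(2,3) by auto
  then show ?thesis using assms(1) unfolding locally_integrable_def by blast
qed

text \<open>The bumps are bounded by 1 and supported in \<open>[a,b]\<close>, where \<open>f\<close> is integrable, so dominated
convergence turns orthogonality to all bumps into orthogonality to the indicator of \<open>[a,b]\<close>.\<close>

lemma integral_Icc_eq_0_of_test_functions:
  fixes f :: "real \<Rightarrow> real"
  assumes f: "locally_integrable {0<..<1} f"
    and orth: "\<And>\<phi>. test_function {0<..<1} \<phi> \<Longrightarrow> (LINT x:{0<..<1}|lborel. f x * \<phi> x) = 0"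
    and ab: "0 < a" "b < 1"
  shows "(LINT x:{a..b}|lborel. f x) = 0"
proof (cases "a \<le> b")
  case True
  have int: "set_integrable lborel {a..b} f"
    using locally_integrable_Icc[OF f ab] .
  let ?s = "\<lambda>n x. indicator {a..b} x * f x * bump a b n x"
  have meas: "(\<lambda>x. indicator {a..b} x * f x) \<in> borel_measurable lborel"
    using int by (auto simp: set_integrable_def)
  have "(\<lambda>n. integral\<^sup>L lborel (?s n)) \<longlonglongrightarrow> integral\<^sup>L lborel (\<lambda>x. indicator {a..b} x * f x)"
  proof (rule integral_dominated_convergence)
    show "integrable lborel (\<lambda>x. \<bar>indicator {a..b} x * f x\<bar>)"
      using int by (auto simp: set_integrable_def)
    show "AE x in lborel. (\<lambda>n. ?s n x) \<longlonglongrightarrow> indicator {a..b} x * f x"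
    proof -
      have "AE x in lborel. x \<notin> {a, b}"
        by (intro AE_not_in countable_imp_null_set_lborel) auto
      then show ?thesis
      proof eventually_elim
        case (elim x)
        show ?case
        proof (cases "x \<in> {a..b}")
          case True
          with elim have "(\<lambda>n. bump a b n x) \<longlonglongrightarrow> 1"
            using ab by (intro bump_tendsto_1) auto
          from tendsto_mult[OF tendsto_const this] show ?thesis by simp
        qed simp
      qed
    qed
    show "AE x in lborel. norm (?s n x) \<le> \<bar>indicator {a..b} x * f x\<bar>" for n
    proof (rule AE_I2)
      fix x
      show "norm (?s n x) \<le> \<bar>indicator {a..b} x * f x\<bar>"
        using bump_01[of a b n x] ab True by (auto simp: abs_mult indicator_def intro!: mult_left_le)
    qed
  qed (use meas in measurable)
  moreover have "integral\<^sup>L lborel (?s n) = 0" for n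
  proof -
    have "(LINT x:{0<..<1}|lborel. f x * bump a b n x) = 0"
      using ab True by (intro orth test_function_bump) auto
    moreover have "(LINT x:{0<..<1}|lborel. f x * bump a b n x) = integral\<^sup>L lborel (?s n)"
      unfolding set_lebesgue_integral_def
      using bump_eq_0[OF _ True] ab
      by (intro Bochner_Integration.integral_cong) (auto simp: indicator_def)
    ultimately show ?thesis by simp
  qed
  ultimately show ?thesis
    by (simp add: set_lebesgue_integral_def LIMSEQ_const_iff)
next
  case False
  then show ?thesis by (simp add: set_lebesgue_integral_def)
qed

text \<open>The sets over which \<open>f\<close> integrates to zero form a Dynkin system. It contains the compact intervals,
which are stable under intersection and generate the Borel sets.\<close>

lemma AE_eq_0_of_Icc_integrals:
  fixes f :: "real \<Rightarrow> real"
  assumes int: "integrable lborel f"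
    and zero: "\<And>a b. (LINT x:{a..b}|lborel. f x) = 0"
  shows "AE x in lborel. f x = 0"
proof (rule sigma_finite_measure.density_zero[OF sigma_finite_lborel int])
  have sint: "set_integrable lborel A f" if "A \<in> sets borel" for A
    using int that unfolding set_integrable_def
    by (intro integrable_mult_indicator) auto
  \<comment> \<open>Closure of the Dynkin system under complements starts from the whole line, an increasing limit of compact intervals.\<close>
  have whole: "(LINT x|lborel. f x) = 0"
  proof -
    have "(\<lambda>n. LINT x:{- real n..real n}|lborel. f x) \<longlonglongrightarrow> (LINT x:(\<Union>n. {- real n..real n})|lborel. f x)"
      by (intro set_integral_cont_up sint) (auto simp: incseq_def)
    moreover have "(\<Union>n. {- real n..real n}) = UNIV"
    proof -
      have "x \<in> {- real (nat \<lceil>\<bar>x\<bar>\<rceil>)..real (nat \<lceil>\<bar>x\<bar>\<rceil>)}" for x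
        by auto linarith+
      then show ?thesis by blast
    qed
    ultimately have "(\<lambda>n::nat. 0) \<longlonglongrightarrow> (LINT x:UNIV|lborel. f x)"
      by (simp only: zero)
    then show ?thesis
      by (simp add: LIMSEQ_const_iff set_lebesgue_integral_def)
  qed
  fix A :: "real set" assume "A \<in> sets lborel"
  have "Int_stable (range (\<lambda>(a, b). {a..b :: real}))"
    by (auto simp: Int_stable_def)
  moreover have "range (\<lambda>(a, b). {a..b :: real}) \<subseteq> Pow UNIV"
    by simp
  moreover have "A \<in> sigma_sets UNIV (range (\<lambda>(a, b). {a..b}))"
    using \<open>A \<in> sets lborel\<close> by (simp add: borel_eq_atLeastAtMost)
  ultimately show "(LINT x:A|lborel. f x) = 0"
  proof (induction A rule: sigma_sets_induct_disjoint)
    case (compl A)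
    then have A: "A \<in> sets borel"
      by (simp add: borel_eq_atLeastAtMost)
    have "(LINT x:(A \<union> (UNIV - A))|lborel. f x)
        = (LINT x:A|lborel. f x) + (LINT x:(UNIV - A)|lborel. f x)"
      using A by (intro set_integral_Un sint) auto
    then show ?case
      using compl whole by (simp add: set_lebesgue_integral_def)
  next
    case (union A)
    then have A: "A i \<in> sets borel" for i
      by (auto simp: borel_eq_atLeastAtMost)
    have "(LINT x:(\<Union>i. A i)|lborel. f x) = (\<Sum>i. LINT x:A i|lborel. f x)"
      using A union by (intro lebesgue_integral_countable_add sint)
        (auto simp: disjoint_family_on_def)
    then show ?case using union by simp
  qed (auto simp: zero set_lebesgue_integral_def[of _ "{}"])
qed

text \<open>As \<open>f\<close> is only locally integrable, the interval criterion is applied to its restrictions to compact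
intervals that exhaust \<open>(0,1)\<close>; countably many exceptional null sets remain a null set.\<close>

lemma fundamental_lemma_of_calculus_of_variations:
  fixes f :: "real \<Rightarrow> real"
  assumes f: "locally_integrable {0<..<1} f"
    and orth: "\<And>\<phi>. test_function {0<..<1} \<phi> \<Longrightarrow> (LINT x:{0<..<1}|lborel. f x * \<phi> x) = 0"
  shows "AE x\<in>{0<..<1} in lborel. f x = 0"
proof -
  let ?K = "\<lambda>n. {1 / real (n + 2)..1 - 1 / real (n + 2)}"
  have "AE x in lborel. indicator (?K n) x * f x = 0" for n
  proof (rule AE_eq_0_of_Icc_integrals)
    show "integrable lborel (\<lambda>x. indicator (?K n) x * f x)"
      using locally_integrable_Icc[OF f, of "1 / real (n + 2)" "1 - 1 / real (n + 2)"]
      by (simp add: set_integrable_def)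
    fix a b :: real
    have "(LINT x:{a..b}|lborel. indicator (?K n) x * f x)
        = (LINT x:{max a (1 / real (n + 2))..min b (1 - 1 / real (n + 2))}|lborel. f x)"
      unfolding set_lebesgue_integral_def
      by (intro Bochner_Integration.integral_cong) (auto simp: indicator_def)
    also have "\<dots> = 0"
      by (rule integral_Icc_eq_0_of_test_functions[OF f orth])
        (simp_all add: less_max_iff_disj min_less_iff_disj)
    finally show "(LINT x:{a..b}|lborel. indicator (?K n) x * f x) = 0" .
  qed
  then have "AE x in lborel. \<forall>n. indicator (?K n) x * f x = 0"
    by (intro AE_all_countable[THEN iffD2] allI)
  then show ?thesis
  proof eventually_elim
    case (elim x)
    show ?case
    proof
      assume x: "x \<in> {0<..<1}"
      then obtain n where n: "inverse (real (Suc n)) < min x (1 - x)"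
        using reals_Archimedean[of "min x (1 - x)"] by auto
      have "1 / real (n + 2) \<le> inverse (real (Suc n))"
        by (simp add: field_simps)
      with n have "x \<in> ?K n" by auto
      then show "f x = 0" using elim[rule_format, of n] by simp
    qed
  qed
qed

lemma weak_derivative_unique:
  assumes "is_weak_derivative {0<..<1} v f" "is_weak_derivative {0<..<1} v g"
  shows "AE x\<in>{0<..<1} in lborel. f x = g x"
proof -
  have "AE x\<in>{0<..<1} in lborel. f x - g x = 0"
  proof (rule fundamental_lemma_of_calculus_of_variations)
    show "locally_integrable {0<..<1} (\<lambda>x. f x - g x)"
      using assms by (auto simp: is_weak_derivative_def locally_integrable_def intro!: set_integral_diff)
    fix \<phi> assume \<phi>: "test_function {0<..<1} \<phi>"
    let ?S = "closure {x. \<phi> x \<noteq> 0}"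
    have cont: "continuous_on UNIV \<phi>"
      using \<phi> C1_differentiable_imp_continuous_on test_function_def by blast
    have S: "compact ?S" "?S \<subseteq> {0<..<1}"
      using \<phi> by (auto simp: test_function_def)
    \<comment> \<open>Linearity of the integral needs each product to be integrable: the test function is bounded and has compact support.\<close>
    have int: "set_integrable lborel {0<..<1} (\<lambda>x. k x * \<phi> x)"
      if "locally_integrable {0<..<1} k" for k
    proof -
      obtain B where B: "\<And>x. x \<in> ?S \<Longrightarrow> \<bar>\<phi> x\<bar> \<le> B"
        using compact_imp_bounded[OF compact_continuous_image[OF continuous_on_subset[OF cont] S(1)]]
        by (auto simp: bounded_iff)
      have k: "set_integrable lborel ?S k"
        using that S by (auto simp: locally_integrable_def)
      have [measurable]: "\<phi> \<in> borel_measurable borel"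
        by (rule borel_measurable_continuous_onI[OF cont])
      have eq: "indicat_real {0<..<1} x *\<^sub>R (k x * \<phi> x) = (indicat_real ?S x *\<^sub>R k x) * \<phi> x" for x
        using S(2) closure_subset[of "{x. \<phi> x \<noteq> 0}"] by (auto simp: indicator_def)
      have m: "(\<lambda>x. indicat_real ?S x *\<^sub>R k x) \<in> borel_measurable lborel"
        using k by (auto simp: set_integrable_def)
      show ?thesis
        unfolding set_integrable_def eq
      proof (rule Bochner_Integration.integrable_bound)
        show "integrable lborel (\<lambda>x. B * (indicat_real ?S x *\<^sub>R k x))"
          using k by (auto simp: set_integrable_def)
        show "AE x in lborel. norm (indicat_real ?S x *\<^sub>R k x * \<phi> x) \<le> norm (B * (indicat_real ?S x *\<^sub>R k x))"
        proof (rule AE_I2)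
          fix x
          show "norm (indicat_real ?S x *\<^sub>R k x * \<phi> x) \<le> norm (B * (indicat_real ?S x *\<^sub>R k x))"
            using mult_right_mono[OF order_trans[OF B abs_ge_self], of x "\<bar>k x\<bar>"]
            by (cases "x \<in> ?S") (auto simp: abs_mult mult.commute)
        qed
      qed (use m in measurable)
    qed
    have "(LINT x:{0<..<1}|lborel. (f x - g x) * \<phi> x)
        = (LINT x:{0<..<1}|lborel. f x * \<phi> x) - (LINT x:{0<..<1}|lborel. g x * \<phi> x)"
      using assms by (simp add: left_diff_distrib set_integral_diff(2) int is_weak_derivative_def)
    also have "\<dots> = 0"
      using assms \<phi> by (simp add: is_weak_derivative_def)
    finally show "(LINT x:{0<..<1}|lborel. (f x - g x) * \<phi> x) = 0" .
  qed
  then show ?thesis by simp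
qed

text \<open>The representative chosen by \<open>weak_dx\<close> is arbitrary, so its measurability has to come from local
integrability. Without it, equality almost everywhere would not determine Bochner integrals.\<close>

lemma locally_integrable_imp_measurable:
  assumes "locally_integrable {0<..<1} g"
  shows "(\<lambda>x. indicator {0<..<1} x * g x) \<in> borel_measurable borel"
proof (rule borel_measurable_LIMSEQ_real)
  let ?K = "\<lambda>n. {1 / real (n + 2)..1 - 1 / real (n + 2)}"
  show "(\<lambda>x. indicator (?K n) x * g x) \<in> borel_measurable borel" for n
  proof -
    have "set_integrable lborel (?K n) g"
      by (rule locally_integrable_Icc[OF assms]) auto
    then show ?thesis by (auto simp: set_integrable_def dest: borel_measurable_integrable)
  qed
  fix x :: real
  show "(\<lambda>n. indicator (?K n) x * g x) \<longlonglongrightarrow> indicator {0<..<1} x * g x"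
  proof (cases "x \<in> {0<..<1}")
    case True
    have "(\<lambda>n. 1 / real (n + 2)) \<longlonglongrightarrow> 0"
      using LIMSEQ_ignore_initial_segment[OF lim_1_over_n, of 2] by simp
    then have "\<forall>\<^sub>F n in sequentially. 1 / real (n + 2) < min x (1 - x)"
      by (rule order_tendstoD) (use True in auto)
    then have "\<forall>\<^sub>F n in sequentially. indicator (?K n) x * g x = indicator {0<..<1} x * g x"
      by eventually_elim (use True in auto)
    then show ?thesis by (rule tendsto_eventually)
  next
    case False
    have "indicator (?K n) x * g x = indicator {0<..<1} x * g x" for n
    proof -
      have "0 < 1 / real (n + 2)" by simp
      then have "x \<notin> ?K n"
        using False unfolding greaterThanLessThan_iff atLeastAtMost_iff by linarith
      then show ?thesis using False by simp
    qed
    then show ?thesis by (simp only: tendsto_const)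
  qed
qed

section \<open>Weak derivatives of finite element functions\<close>

text \<open>Cells are numbered from 1: cell \<open>j\<close> lies between the nodes \<open>j - 1\<close> and \<open>j\<close>.\<close>

definition slope :: "nat \<Rightarrow> (real \<Rightarrow> real) \<Rightarrow> nat \<Rightarrow> real" where
  "slope J v j = (v (real j * mesh_width J) - v ((real j - 1) * mesh_width J)) / mesh_width J"

text \<open>The ceiling of \<open>x J\<close> is the number of the cell that contains \<open>x\<close>, the right end point included. In
this form a function applied to a step function is definitionally a step function again.\<close>

definition step :: "nat \<Rightarrow> (nat \<Rightarrow> real) \<Rightarrow> real \<Rightarrow> real" where
  "step J c x = c (nat \<lceil>x * real J\<rceil>)"

lemma mesh_width_pos: "J \<ge> 1 \<Longrightarrow> mesh_width J > 0"
  by (simp add: mesh_width_def)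

lemma step_eq:
  assumes "J \<ge> 1" "j \<ge> 1" "(real j - 1) * mesh_width J < x" "x \<le> real j * mesh_width J"
  shows "step J c x = c j"
proof -
  have "real j - 1 < x * real J" "x * real J \<le> real j"
    using assms by (auto simp: mesh_width_def field_simps)
  then have "\<lceil>x * real J\<rceil> = int j"
    by (intro ceiling_unique) auto
  then show ?thesis by (simp add: step_def)
qed

lemma mesh_cell_exists:
  assumes "J \<ge> 1" "0 < x" "x \<le> 1"
  obtains j where "j \<in> {1..J}" "(real j - 1) * mesh_width J < x" "x \<le> real j * mesh_width J"
proof
  let ?j = "nat \<lceil>x * real J\<rceil>"
  have pos: "x * real J > 0" using assms by simp
  then have j: "real ?j = of_int \<lceil>x * real J\<rceil>" by (simp add: of_nat_nat)
  have "x * real J \<le> 1 * real J" using assms by (intro mult_right_mono) auto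
  then have "?j \<le> J" by (simp add: nat_le_iff ceiling_le_iff)
  moreover have "?j \<ge> 1" using pos by linarith
  ultimately show "?j \<in> {1..J}" by simp
  have "real ?j - 1 < x * real J" "x * real J \<le> real ?j"
    unfolding j by linarith+
  then show "(real ?j - 1) * mesh_width J < x" "x \<le> real ?j * mesh_width J"
    using assms by (auto simp: mesh_width_def field_simps)
qed

lemma mesh_cell_subset:
  assumes "J \<ge> 1" "j \<in> {1..J}"
  shows "0 \<le> (real j - 1) * mesh_width J" "real j * mesh_width J \<le> 1"
  using assms by (auto simp: mesh_width_def field_simps)

lemma step_indicator_sum:
  assumes "J \<ge> 1" "x \<in> {0<..1}"
  shows "step J c x = (\<Sum>j=1..J. c j * indicator {(real j - 1) * mesh_width J<..real j * mesh_width J} x)"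
proof -
  obtain i where i: "i \<in> {1..J}" "(real i - 1) * mesh_width J < x" "x \<le> real i * mesh_width J"
    using mesh_cell_exists[of J x] assms by auto
  have "(\<Sum>j=1..J. c j * indicator {(real j - 1) * mesh_width J<..real j * mesh_width J} x)
      = (\<Sum>j\<in>{i}. c j)"
  proof (rule sum.mono_neutral_cong_right)
    show "\<forall>j\<in>{1..J} - {i}. c j * indicator {(real j - 1) * mesh_width J<..real j * mesh_width J} x = 0"
    proof
      fix j assume j: "j \<in> {1..J} - {i}"
      have "\<not> ((real j - 1) * mesh_width J < x \<and> x \<le> real j * mesh_width J)"
        using step_eq[of J j x real] step_eq[of J i x real] i j assms by auto
      then show "c j * indicator {(real j - 1) * mesh_width J<..real j * mesh_width J} x = 0"
        by (auto simp: indicator_def)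
    qed
  qed (use i in auto)
  then show ?thesis
    using step_eq[of J i x c] i assms by simp
qed

lemma borel_measurable_step [measurable]: "step J c \<in> borel_measurable borel"
  unfolding step_def by measurable

lemma integral_step:
  assumes "J \<ge> 1"
  shows "(LINT x:{0<..<1}|lborel. step J c x) = mesh_width J * (\<Sum>j=1..J. c j)"
proof -
  let ?I = "\<lambda>j. {(real j - 1) * mesh_width J<..real j * mesh_width J}"
  have cell: "integrable lborel (\<lambda>x. c j * indicator (?I j) x)"
    and val: "(LINT x|lborel. c j * indicator (?I j) x) = c j * mesh_width J" for j
    using mesh_width_pos[OF assms] by (auto simp: algebra_simps)
  have "(LINT x:{0<..<1}|lborel. step J c x) = (LINT x|lborel. (\<Sum>j=1..J. c j * indicator (?I j) x))"
    unfolding set_lebesgue_integral_def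
  proof (rule integral_cong_AE)
    \<comment> \<open>The last cell contains the point 1, which is not in the domain of integration.\<close>
    have "AE x in lborel. x \<noteq> (1::real)"
      using AE_lborel_singleton .
    then show "AE x in lborel. indicator {0<..<1} x *\<^sub>R step J c x = (\<Sum>j=1..J. c j * indicator (?I j) x)"
    proof eventually_elim
      case (elim x)
      show ?case
      proof (cases "x \<in> {0<..<1}")
        case True
        then show ?thesis using step_indicator_sum[OF assms, of x c] by simp
      next
        case False
        have "c j * indicator (?I j) x = 0" if "j \<in> {1..J}" for j
          using False elim mesh_cell_subset[OF assms that] by (auto simp: indicator_def)
        then have "(\<Sum>j=1..J. c j * indicator (?I j) x) = 0"
          by (rule sum.neutral[OF ballI])
        moreover have "indicator {0<..<1} x *\<^sub>R step J c x = 0"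
          using False by simp
        ultimately show ?thesis by (simp only:)
      qed
    qed
    show "(\<lambda>x. indicator {0<..<1} x *\<^sub>R step J c x) \<in> borel_measurable lborel"
      by measurable
    show "(\<lambda>x. \<Sum>j=1..J. c j * indicator (?I j) x) \<in> borel_measurable lborel"
      by (intro borel_measurable_sum borel_measurable_integrable cell)
  qed
  also have "\<dots> = (\<Sum>j=1..J. c j * mesh_width J)"
    by (subst Bochner_Integration.integral_sum[OF cell]) (simp only: val)
  finally show ?thesis
    by (simp add: sum_distrib_left mult.commute)
qed

lemma fe_space_affine:
  assumes "J \<ge> 1" "v \<in> fe_space J" "j \<in> {1..J}"
    and x: "x \<in> {(real j - 1) * mesh_width J..real j * mesh_width J}"
  shows "v x = v ((real j - 1) * mesh_width J) + slope J v j * (x - (real j - 1) * mesh_width J)"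
proof -
  have h: "mesh_width J > 0" using mesh_width_pos[OF assms(1)] .
  obtain a b where ab: "\<And>x. x \<in> {(real j - 1) * mesh_width J..real j * mesh_width J} \<Longrightarrow> v x = a + b * x"
    using assms(2,3) unfolding fe_space_def by blast
  have "(real j - 1) * mesh_width J \<le> real j * mesh_width J"
    using h by (intro mult_right_mono) auto
  then have e: "v (real j * mesh_width J) = a + b * (real j * mesh_width J)"
      "v ((real j - 1) * mesh_width J) = a + b * ((real j - 1) * mesh_width J)"
    by (auto intro!: ab)
  then have "slope J v j = b"
    using h by (simp add: slope_def field_simps)
  then show ?thesis
    using ab[OF x] e by (simp add: algebra_simps)
qed

lemma fe_space_has_derivative:
  assumes "J \<ge> 1" "v \<in> fe_space J"
    and x: "x \<in> {0<..<1} - (\<lambda>j. real j * mesh_width J) ` {..J}"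
  shows "(v has_real_derivative step J (slope J v) x) (at x)"
proof -
  obtain j where j: "j \<in> {1..J}" "(real j - 1) * mesh_width J < x" "x \<le> real j * mesh_width J"
    using mesh_cell_exists[of J x] assms by auto
  let ?S = "{(real j - 1) * mesh_width J<..<real j * mesh_width J}"
  have "((\<lambda>x. v ((real j - 1) * mesh_width J) + slope J v j * (x - (real j - 1) * mesh_width J))
      has_real_derivative slope J v j) (at x)"
    by (auto intro!: derivative_eq_intros)
  then have "(v has_real_derivative slope J v j) (at x)"
  proof (rule has_field_derivative_transform_within_open[where S = ?S])
    show "x \<in> ?S"
      using x j by (auto simp: less_le)
    show "v ((real j - 1) * mesh_width J) + slope J v j * (y - (real j - 1) * mesh_width J) = v y"
      if "y \<in> ?S" for y
      using fe_space_affine[OF assms(1,2) j(1), of y] that by simp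
  qed simp
  then show ?thesis
    using step_eq[OF assms(1) _ j(2,3)] j(1) by simp
qed

lemma step_bounded:
  obtains B where "\<And>x. x \<in> {0..1} \<Longrightarrow> \<bar>step J c x\<bar> \<le> B"
proof
  fix x :: real assume x: "x \<in> {0..1}"
  have "x * real J \<le> 1 * real J" using x by (intro mult_right_mono) auto
  then have "nat \<lceil>x * real J\<rceil> \<in> {..J}" by (simp add: nat_le_iff ceiling_le_iff)
  then show "\<bar>step J c x\<bar> \<le> (\<Sum>j\<le>J. \<bar>c j\<bar>)"
    unfolding step_def by (intro member_le_sum) auto
qed

lemma set_integrable_step_mult:
  assumes "continuous_on UNIV f" "A \<in> sets borel" "A \<subseteq> {0..1}"
  shows "set_integrable lborel A (\<lambda>x. step J c x * f x)"
proof -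
  obtain B where B: "\<And>x. x \<in> {0..1} \<Longrightarrow> \<bar>step J c x\<bar> \<le> B"
    using step_bounded by blast
  have [measurable]: "f \<in> borel_measurable borel"
    by (rule borel_measurable_continuous_onI[OF assms(1)])
  have "set_integrable lborel {0..1} (\<lambda>x. B * f x)"
    unfolding set_integrable_def
    by (intro borel_integrable_compact) (auto intro!: continuous_intros continuous_on_subset[OF assms(1)])
  then have "set_integrable lborel {0..1} (\<lambda>x. step J c x * f x)"
  proof (rule set_integrable_bound)
    show "AE x in lborel. x \<in> {0..1} \<longrightarrow> norm (step J c x * f x) \<le> norm (B * f x)"
    proof (rule AE_I2, rule impI)
      fix x :: real assume "x \<in> {0..1}"
      then show "norm (step J c x * f x) \<le> norm (B * f x)"
        using B[of x] by (auto simp: abs_mult intro!: mult_right_mono)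
    qed
  qed (auto simp: set_borel_measurable_def)
  then show ?thesis
    by (rule set_integrable_subset) (use assms in auto)
qed

lemma fe_space_continuous:
  assumes "v \<in> fe_space J" shows "continuous_on {0..1} v"
  using assms by (simp add: fe_space_def)

text \<open>For a test function \<open>\<phi>\<close>, the product \<open>v \<phi>\<close> is continuous on \<open>[0,1]\<close>, differentiable off the finitely
many nodes, and vanishes at both ends. The fundamental theorem of calculus, which tolerates finitely
many exceptional points, gives the integration by parts.\<close>

lemma fe_space_weak_derivative:
  assumes "J \<ge> 1" "v \<in> fe_space J"
  shows "is_weak_derivative {0<..<1} v (step J (slope J v))"
  unfolding is_weak_derivative_def
proof (intro conjI allI impI)
  show "locally_integrable {0<..<1} v"
    unfolding locally_integrable_def set_integrable_def
  proof (intro allI impI)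
    fix K :: "real set" assume K: "compact K \<and> K \<subseteq> {0<..<1}"
    then have "continuous_on K v"
      by (intro continuous_on_subset[OF fe_space_continuous[OF assms(2)]]) auto
    then show "integrable lborel (\<lambda>x. indicat_real K x *\<^sub>R v x)"
      using K by (intro borel_integrable_compact) auto
  qed
  show "locally_integrable {0<..<1} (step J (slope J v))"
    unfolding locally_integrable_def
  proof (intro allI impI)
    fix K :: "real set" assume K: "compact K \<and> K \<subseteq> {0<..<1}"
    then have "K \<in> sets borel" "K \<subseteq> {0..1}"
      by (auto simp: borel_compact)
    then show "set_integrable lborel K (step J (slope J v))"
      using set_integrable_step_mult[of "\<lambda>_. 1" K J "slope J v"] by simp
  qed
  fix \<phi> assume "test_function {0<..<1} \<phi>"
  then have C1: "\<phi> C1_differentiable_on UNIV" and "closure {x. \<phi> x \<noteq> 0} \<subseteq> {0<..<1}"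
    by (auto simp: test_function_def)
  then have ends: "\<phi> 0 = 0" "\<phi> 1 = 0"
    using closure_subset[of "{x. \<phi> x \<noteq> 0}"] by force+
  obtain D where D: "\<And>x. (\<phi> has_real_derivative D x) (at x)" and contD: "continuous_on UNIV D"
    using C1 unfolding C1_differentiable_on_def has_real_derivative_iff_has_vector_derivative by auto
  have deriv: "deriv \<phi> = D"
    using D DERIV_imp_deriv by blast
  have cont: "continuous_on UNIV \<phi>"
    using D by (meson DERIV_continuous_on has_field_derivative_at_within)
  let ?g = "step J (slope J v)"
  have "((\<lambda>x. ?g x * \<phi> x + v x * D x) has_integral v 1 * \<phi> 1 - v 0 * \<phi> 0) {0..1}"
  proof (rule fundamental_theorem_of_calculus_interior_strong)
    show "finite ((\<lambda>j. real j * mesh_width J) ` {..J})" by simp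
    show "continuous_on {0..1} (\<lambda>x. v x * \<phi> x)"
      using fe_space_continuous[OF assms(2)] continuous_on_subset[OF cont]
      by (auto intro!: continuous_intros)
    fix x assume "x \<in> {0<..<1} - (\<lambda>j. real j * mesh_width J) ` {..J}"
    from DERIV_mult[OF fe_space_has_derivative[OF assms this] D]
    show "((\<lambda>x. v x * \<phi> x) has_vector_derivative ?g x * \<phi> x + v x * D x) (at x)"
      by (simp add: has_real_derivative_iff_has_vector_derivative mult.commute add.commute)
  qed simp
  then have zero: "integral {0..1} (\<lambda>x. ?g x * \<phi> x + v x * D x) = 0"
    using ends by (simp add: integral_unique)
  have i1: "set_integrable lborel {0..1} (\<lambda>x. ?g x * \<phi> x)"
    using set_integrable_step_mult[OF cont] by auto
  have i2: "set_integrable lborel {0..1} (\<lambda>x. v x * D x)"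
    unfolding set_integrable_def
    using fe_space_continuous[OF assms(2)] continuous_on_subset[OF contD]
    by (intro borel_integrable_compact) (auto intro!: continuous_intros)
  have "(LINT x:{0..1}|lborel. ?g x * \<phi> x) + (LINT x:{0..1}|lborel. v x * D x) = 0"
    using zero set_borel_integral_eq_integral(2)[OF set_integral_add(1)[OF i1 i2]]
      set_integral_add(2)[OF i1 i2] by simp
  moreover have "(LINT x:{0..1}|lborel. ?g x * \<phi> x) = (LINT x:{0<..<1}|lborel. ?g x * \<phi> x)"
    unfolding set_lebesgue_integral_def
    using ends by (intro Bochner_Integration.integral_cong) (auto simp: indicator_def less_le)
  moreover have "(LINT x:{0..1}|lborel. v x * D x) = (LINT x:{0<..<1}|lborel. v x * D x)"
    unfolding set_lebesgue_integral_def
    using assms(2) by (intro Bochner_Integration.integral_cong)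
      (auto simp: indicator_def less_le fe_space_def)
  ultimately show "(LINT x:{0<..<1}|lborel. v x * deriv \<phi> x) = - (LINT x:{0<..<1}|lborel. ?g x * \<phi> x)"
    by (simp add: deriv)
qed

lemma weak_dx_fe_space:
  assumes "J \<ge> 1" "v \<in> fe_space J"
  shows "AE x\<in>{0<..<1} in lborel. weak_dx v x = step J (slope J v) x"
    and "(\<lambda>x. indicator {0<..<1} x * weak_dx v x) \<in> borel_measurable borel"
proof -
  note w = fe_space_weak_derivative[OF assms]
  have d: "is_weak_derivative {0<..<1} v (weak_dx v)"
    unfolding weak_dx_def by (rule someI[of _ "step J (slope J v)"]) (rule w)
  show "AE x\<in>{0<..<1} in lborel. weak_dx v x = step J (slope J v) x"
    using weak_derivative_unique[OF d w] .
  show "(\<lambda>x. indicator {0<..<1} x * weak_dx v x) \<in> borel_measurable borel"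
    using d by (intro locally_integrable_imp_measurable) (auto simp: is_weak_derivative_def)
qed

text \<open>This is the passage to finite sums: whatever representative is chosen, integrals of weak derivatives
of finite element functions only see the slopes.\<close>

lemma integral_weak_dx:
  fixes F :: "real \<Rightarrow> real"
  assumes "J \<ge> 1" "v \<in> fe_space J" "w \<in> fe_space J" and [measurable]: "F \<in> borel_measurable borel"
  shows "(LINT x:{0<..<1}|lborel. F (weak_dx v x) * weak_dx w x)
      = mesh_width J * (\<Sum>j=1..J. F (slope J v j) * slope J w j)"
proof -
  note [measurable] = weak_dx_fe_space(2)[OF assms(1,2)] weak_dx_fe_space(2)[OF assms(1,3)]
  let ?i = "indicat_real {0<..<1}"
  \<comment> \<open>Measurability is known only for the restrictions to the unit interval, hence the repeated indicator.\<close>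
  have "(LINT x:{0<..<1}|lborel. F (weak_dx v x) * weak_dx w x)
      = (LINT x|lborel. ?i x * (F (?i x * weak_dx v x) * (?i x * weak_dx w x)))"
    unfolding set_lebesgue_integral_def
    by (intro Bochner_Integration.integral_cong) (auto simp: indicator_def)
  also have "\<dots> = (LINT x|lborel. ?i x * step J (\<lambda>j. F (slope J v j) * slope J w j) x)"
  proof (rule integral_cong_AE)
    show "AE x in lborel. ?i x * (F (?i x * weak_dx v x) * (?i x * weak_dx w x))
        = ?i x * step J (\<lambda>j. F (slope J v j) * slope J w j) x"
      using weak_dx_fe_space(1)[OF assms(1,2)] weak_dx_fe_space(1)[OF assms(1,3)]
      by eventually_elim (auto simp: indicator_def step_def)
  qed measurable
  also have "\<dots> = mesh_width J * (\<Sum>j=1..J. F (slope J v j) * slope J w j)"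
    using integral_step[OF assms(1), of "\<lambda>j. F (slope J v j) * slope J w j"]
    by (simp add: set_lebesgue_integral_def)
  finally show ?thesis .
qed

section \<open>Nodal values and hat functions\<close>

lemma fe_space_eq_0:
  assumes "v \<in> fe_space J" "x \<notin> {0<..<1}"
  shows "v x = 0"
proof -
  have "x = 0 \<or> x = 1 \<or> x \<notin> {0..1}"
    using assms(2) by auto
  then show ?thesis
    using assms(1) unfolding fe_space_def by blast
qed

text \<open>A finite element function is determined by its values at the interior nodes, because these and the
boundary values fix both its slope and its left end value on every cell.\<close>

lemma fe_space_eqI:
  assumes "J \<ge> 1" "v \<in> fe_space J" "w \<in> fe_space J"
    and nodes: "\<And>j. j \<in> {1..J-1} \<Longrightarrow> v (real j * mesh_width J) = w (real j * mesh_width J)"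
  shows "v = w"
proof
  have all: "v (real j * mesh_width J) = w (real j * mesh_width J)" if "j \<le> J" for j
  proof -
    consider "j \<in> {1..J-1}" | "real j * mesh_width J \<notin> {0<..<1}"
    proof (cases "j = 0 \<or> j = J")
      case True
      then have "real j * mesh_width J \<notin> {0<..<1}"
        using assms(1) by (auto simp: mesh_width_def)
      then show ?thesis using that(2) by blast
    next
      case False
      then have "j \<in> {1..J-1}" using \<open>j \<le> J\<close> by auto
      then show ?thesis using that(1) by blast
    qed
    then show ?thesis
      using nodes fe_space_eq_0[OF assms(2)] fe_space_eq_0[OF assms(3)] by cases auto
  qed
  fix x
  show "v x = w x"
  proof (cases "x \<in> {0<..<1}")
    case True
    then have "0 < x" "x \<le> 1" by auto
    from mesh_cell_exists[OF assms(1) this]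
    obtain j where j: "j \<in> {1..J}" "(real j - 1) * mesh_width J < x" "x \<le> real j * mesh_width J"
      .
    have "v ((real j - 1) * mesh_width J) = w ((real j - 1) * mesh_width J)"
    proof -
      have "j - 1 \<le> J" using j(1) by auto
      from all[OF this] show ?thesis using j(1) by (simp add: of_nat_diff)
    qed
    moreover from this have "slope J v j = slope J w j"
      using all[of j] j(1) by (simp add: slope_def)
    ultimately show ?thesis
      using fe_space_affine[OF assms(1,2) j(1), of x] fe_space_affine[OF assms(1,3) j(1), of x] j
      by simp
  next
    case False
    then show ?thesis
      using fe_space_eq_0[OF assms(2)] fe_space_eq_0[OF assms(3)] by simp
  qed
qed

lemma fe_space_scale: "v \<in> fe_space J \<Longrightarrow> (\<lambda>x. c * v x) \<in> fe_space J"
  unfolding fe_space_def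
proof (safe, goal_cases)
  case (4 j)
  then obtain a b where "\<forall>x\<in>{(real j - 1) * mesh_width J..real j * mesh_width J}. v x = a + b * x"
    by blast
  then show ?case
    by (intro exI[of _ "c * a"] exI[of _ "c * b"]) (auto simp: algebra_simps)
qed (auto intro!: continuous_intros)

lemma fe_space_add:
  "v \<in> fe_space J \<Longrightarrow> w \<in> fe_space J \<Longrightarrow> (\<lambda>x. v x + w x) \<in> fe_space J"
  unfolding fe_space_def
proof (safe, goal_cases)
  case (4 j)
  then obtain a b a' b' where
    "\<forall>x\<in>{(real j - 1) * mesh_width J..real j * mesh_width J}. v x = a + b * x"
    "\<forall>x\<in>{(real j - 1) * mesh_width J..real j * mesh_width J}. w x = a' + b' * x"
    by meson
  then show ?case
    by (intro exI[of _ "a + a'"] exI[of _ "b + b'"]) (auto simp: algebra_simps)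
qed (auto intro!: continuous_intros)

lemma fe_space_sum:
  "finite A \<Longrightarrow> (\<And>i. i \<in> A \<Longrightarrow> f i \<in> fe_space J) \<Longrightarrow> (\<lambda>x. \<Sum>i\<in>A. f i x) \<in> fe_space J"
proof (induction A rule: finite_induct)
  case empty
  then show ?case by (auto simp: fe_space_def intro!: exI[of _ 0])
next
  case (insert i A)
  then show ?case using fe_space_add[of "f i" J "\<lambda>x. \<Sum>i\<in>A. f i x"] by simp
qed

definition hat :: "nat \<Rightarrow> nat \<Rightarrow> real \<Rightarrow> real" where
  "hat J i x = max 0 (1 - \<bar>x * real J - real i\<bar>)"

lemma hat_fe_space:
  assumes "J \<ge> 1" "i \<in> {1..J-1}"
  shows "hat J i \<in> fe_space J"
  unfolding fe_space_def mem_Collect_eq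
proof (intro conjI ballI allI impI)
  show "continuous_on {0..1} (hat J i)"
    unfolding hat_def by (intro continuous_intros)
  show "hat J i 0 = 0" "hat J i 1 = 0"
    using assms by (auto simp: hat_def)
next
  fix x :: real assume "x \<notin> {0..1}"
  then consider "x < 0" | "x > 1" by force
  then have "x * real J \<le> 0 \<or> x * real J \<ge> real J"
    by cases (auto simp: mult_nonpos_nonneg mult_le_cancel_right1)
  moreover have "1 \<le> real i" "real i \<le> real J - 1"
    using assms by auto
  ultimately have "1 \<le> \<bar>x * real J - real i\<bar>"
    by linarith
  then show "hat J i x = 0"
    by (simp add: hat_def)
next
  fix j assume j: "j \<in> {1..J}"
  have cell: "real j - 1 \<le> x * real J \<and> x * real J \<le> real j"
    if "x \<in> {(real j - 1) * mesh_width J..real j * mesh_width J}" for x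
    using that assms(1) by (auto simp: mesh_width_def field_simps)
  consider "j = i" | "j = i + 1" | "j < i" | "j > i + 1" by linarith
  then show "\<exists>a b. \<forall>x\<in>{(real j - 1) * mesh_width J..real j * mesh_width J}. hat J i x = a + b * x"
  proof cases
    case 1
    then show ?thesis using cell
      by (intro exI[of _ "1 - real i"] exI[of _ "real J"]) (force simp: hat_def mult.commute)
  next
    case 2
    then show ?thesis using cell
      by (intro exI[of _ "1 + real i"] exI[of _ "- real J"]) (force simp: hat_def mult.commute)
  next
    case 3
    then have "hat J i x = 0" if "x \<in> {(real j - 1) * mesh_width J..real j * mesh_width J}" for x
      using cell[OF that] by (auto simp: hat_def)
    then show ?thesis by (intro exI[of _ 0]) auto
  next
    case 4
    then have "hat J i x = 0" if "x \<in> {(real j - 1) * mesh_width J..real j * mesh_width J}" for x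
      using cell[OF that] by (auto simp: hat_def)
    then show ?thesis by (intro exI[of _ 0]) auto
  qed
qed

lemma hat_node: "J \<ge> 1 \<Longrightarrow> hat J i (real j * mesh_width J) = (if i = j then 1 else 0)"
  by (auto simp: hat_def mesh_width_def)

lemma fe_space_interpolant_exists:
  assumes "J \<ge> 1"
  shows "\<exists>z\<in>fe_space J. \<forall>j\<in>{1..J-1}. z (real j * mesh_width J) = c j"
proof (intro bexI ballI)
  let ?z = "\<lambda>x. \<Sum>i=1..J-1. c i * hat J i x"
  show "?z \<in> fe_space J"
    using assms by (intro fe_space_sum fe_space_scale hat_fe_space) auto
  show "?z (real j * mesh_width J) = c j" if "j \<in> {1..J-1}" for j
    using that assms by (simp add: hat_node if_distrib[of "\<lambda>y. c _ * y"] sum.delta cong: if_cong)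
qed

section \<open>The discrete Laplacian\<close>

lemma summation_by_parts:
  fixes a w :: "nat \<Rightarrow> real"
  shows "(\<Sum>j=1..Suc n. a j * (w j - w (j - 1)))
    = a (Suc n) * w (Suc n) - a 1 * w 0 - (\<Sum>j=1..n. (a (Suc j) - a j) * w j)"
  by (induction n) (auto simp: algebra_simps)

text \<open>Discrete integration by parts. The boundary terms vanish because \<open>w\<close> does at both ends. It is used
twice: with \<open>a\<close> the slopes of \<open>v\<close> it identifies the discrete Laplacian, and with \<open>a\<close> a function of
these slopes it gives the sign of the integral.\<close>

lemma slope_summation_by_parts:
  assumes "J \<ge> 1" "w \<in> fe_space J"
  shows "mesh_width J * (\<Sum>j=1..J. a j * slope J w j)
    = - (\<Sum>j=1..J-1. (a (Suc j) - a j) * w (real j * mesh_width J))"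
proof -
  let ?w = "\<lambda>j. w (real j * mesh_width J)"
  have ends: "?w 0 = 0" "?w J = 0"
    using assms by (auto simp: fe_space_def mesh_width_def)
  have "mesh_width J * (\<Sum>j=1..J. a j * slope J w j) = (\<Sum>j=1..J. a j * (?w j - ?w (j - 1)))"
    unfolding sum_distrib_left
    using mesh_width_pos[OF assms(1)]
    by (intro sum.cong) (auto simp: slope_def of_nat_diff)
  also have "\<dots> = - (\<Sum>j=1..J-1. (a (Suc j) - a j) * ?w j)"
    using summation_by_parts[of a ?w "J - 1"] ends assms(1) by simp
  finally show ?thesis .
qed

text \<open>Mass lumping makes the discrete Laplacian explicit: its nodal values are the difference quotients of
consecutive slopes. The interpolant of these values solves the defining equation by summation by
parts. Testing with the hat function of a node isolates the value there, so the solution is unique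
and the definite description denotes it.\<close>

lemma discrete_laplacian_nodes:
  assumes "J \<ge> 1" "v \<in> fe_space J"
  shows "discrete_laplacian J v \<in> fe_space J"
    and "j \<in> {1..J-1} \<Longrightarrow> discrete_laplacian J v (real j * mesh_width J)
      = (slope J v (Suc j) - slope J v j) / mesh_width J"
proof -
  let ?h = "mesh_width J"
  have h: "?h > 0" using mesh_width_pos[OF assms(1)] .
  let ?P = "\<lambda>z. z \<in> fe_space J \<and>
     (\<forall>w\<in>fe_space J. lumped_inner J z w = - (LINT x:{0<..<1}|lborel. weak_dx v x * weak_dx w x))"
  define c where "c = (\<lambda>j. (slope J v (Suc j) - slope J v j) / ?h)"
  obtain z where z: "z \<in> fe_space J" and nodes: "\<forall>j\<in>{1..J-1}. z (real j * ?h) = c j"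
    using fe_space_interpolant_exists[OF assms(1), of c] by blast
  have "?P z"
  proof (intro conjI ballI z)
    fix w assume w: "w \<in> fe_space J"
    have "lumped_inner J z w = (\<Sum>j=1..J-1. (slope J v (Suc j) - slope J v j) * w (real j * ?h))"
      unfolding lumped_inner_def sum_distrib_left
    proof (rule sum.cong[OF refl])
      fix j assume "j \<in> {1..J-1}"
      with nodes have "z (real j * ?h) = c j" by blast
      then show "?h * (z (real j * ?h) * w (real j * ?h))
          = (slope J v (Suc j) - slope J v j) * w (real j * ?h)"
        using h by (simp add: c_def)
    qed
    also have "\<dots> = - (?h * (\<Sum>j=1..J. slope J v j * slope J w j))"
      using slope_summation_by_parts[OF assms(1) w, of "slope J v"] by simp
    also have "\<dots> = - (LINT x:{0<..<1}|lborel. weak_dx v x * weak_dx w x)"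
      using integral_weak_dx[OF assms w, of "\<lambda>s. s"] by simp
    finally show "lumped_inner J z w = - (LINT x:{0<..<1}|lborel. weak_dx v x * weak_dx w x)" .
  qed
  have unique: "y = z" if y: "?P y" for y
  proof (rule fe_space_eqI[OF assms(1)])
    show "y \<in> fe_space J" "z \<in> fe_space J"
      using y z by blast+
    fix j assume j: "j \<in> {1..J-1}"
    have "lumped_inner J u (hat J j) = ?h * u (real j * ?h)" for u
      using j assms(1) by (simp add: lumped_inner_def hat_node if_distrib[of "\<lambda>y. u _ * y"] sum.delta' cong: if_cong)
    moreover have "lumped_inner J y (hat J j) = lumped_inner J z (hat J j)"
      using y \<open>?P z\<close> hat_fe_space[OF assms(1) j] by simp
    ultimately show "y (real j * ?h) = z (real j * ?h)"
      using h by simp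
  qed
  have "discrete_laplacian J v = z"
    unfolding discrete_laplacian_def by (rule the_equality) (fact \<open>?P z\<close>, rule unique)
  then show "discrete_laplacian J v \<in> fe_space J"
    and "j \<in> {1..J-1} \<Longrightarrow> discrete_laplacian J v (real j * ?h)
      = (slope J v (Suc j) - slope J v j) / ?h"
    using z nodes by (simp_all add: c_def)
qed

section \<open>Monotonicity\<close>

lemma mono_regularised_sign:
  fixes \<epsilon> :: real
  assumes "\<epsilon> > 0"
  shows "mono (\<lambda>s. s / sqrt (\<bar>s\<bar>\<^sup>2 + \<epsilon>\<^sup>2))"
proof (rule monoI)
  fix s t :: real assume "s \<le> t"
  then show "s / sqrt (\<bar>s\<bar>\<^sup>2 + \<epsilon>\<^sup>2) \<le> t / sqrt (\<bar>t\<bar>\<^sup>2 + \<epsilon>\<^sup>2)"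
  proof (rule DERIV_nonneg_imp_nondecreasing)
    fix x :: real
    have p: "x\<^sup>2 + \<epsilon>\<^sup>2 > 0" using assms by (simp add: add_nonneg_pos)
    let ?r = "sqrt (x\<^sup>2 + \<epsilon>\<^sup>2)"
    have quotient: "1 * r - x * (x / r) = (r * r - x\<^sup>2) / r" if "r > 0" for r
      using that by (simp add: field_simps power2_eq_square)
    have r: "?r > 0" "?r * ?r = x\<^sup>2 + \<epsilon>\<^sup>2" using p by auto
    have "((\<lambda>s. s / sqrt (\<bar>s\<bar>\<^sup>2 + \<epsilon>\<^sup>2)) has_real_derivative (1 * ?r - x * (x / ?r)) / (?r * ?r)) (at x)"
      unfolding power2_abs using p by (auto intro!: derivative_eq_intros simp: field_simps)
    moreover have "1 * ?r - x * (x / ?r) = (?r * ?r - x\<^sup>2) / ?r"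
      by (rule quotient) fact
    then have "1 * ?r - x * (x / ?r) = \<epsilon>\<^sup>2 / ?r"
      unfolding r(2) by simp
    then have "(1 * ?r - x * (x / ?r)) / (?r * ?r) \<ge> 0"
      using r(1) by simp
    ultimately show "\<exists>y. ((\<lambda>s. s / sqrt (\<bar>s\<bar>\<^sup>2 + \<epsilon>\<^sup>2)) has_real_derivative y) (at x) \<and> y \<ge> 0"
      by blast
  qed
qed

text \<open>After summation by parts, the integral is a sum over the interior nodes of the increment of \<open>F\<close>
between consecutive slopes times the increment of the slopes divided by the mesh width. Monotonicity
of \<open>F\<close> makes each term nonnegative.\<close>

lemma mono_flux_discrete_laplacian_nonneg:
  fixes F :: "real \<Rightarrow> real"
  assumes J: "J \<ge> 1" and v: "v \<in> fe_space J" and F: "mono F"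
  shows "(LINT x:{0<..<1}|lborel. F (weak_dx v x) * weak_dx (\<lambda>y. - discrete_laplacian J v y) x) \<ge> 0"
proof -
  let ?h = "mesh_width J" and ?z = "discrete_laplacian J v"
  have h: "?h > 0" using mesh_width_pos[OF J] .
  have neg: "(\<lambda>y. - ?z y) \<in> fe_space J"
    using fe_space_scale[OF discrete_laplacian_nodes(1)[OF J v], of "-1"] by simp
  have "(LINT x:{0<..<1}|lborel. F (weak_dx v x) * weak_dx (\<lambda>y. - ?z y) x)
      = ?h * (\<Sum>j=1..J. F (slope J v j) * slope J (\<lambda>y. - ?z y) j)"
    using integral_weak_dx[OF J v neg borel_measurable_mono[OF F]] .
  also have "\<dots> = (\<Sum>j=1..J-1. (F (slope J v (Suc j)) - F (slope J v j)) * ?z (real j * ?h))"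
    using slope_summation_by_parts[OF J neg, of "\<lambda>j. F (slope J v j)"] by (simp add: sum_negf)
  also have "\<dots> \<ge> 0"
  proof (rule sum_nonneg)
    fix j assume j: "j \<in> {1..J-1}"
    have "0 \<le> (F t - F s) * ((t - s) / ?h)" for s t
    proof (cases "s \<le> t")
      case True
      then show ?thesis
        using monoD[OF F, of s t] h by (intro mult_nonneg_nonneg) auto
    next
      case False
      then show ?thesis
        using monoD[OF F, of t s] h by (intro mult_nonpos_nonpos divide_nonpos_pos) auto
    qed
    then show "0 \<le> (F (slope J v (Suc j)) - F (slope J v j)) * ?z (real j * ?h)"
      using discrete_laplacian_nodes(2)[OF J v j] by simp
  qed
  finally show ?thesis .
qed

theorem lemma3p1:
  fixes J :: nat and v :: "real \<Rightarrow> real" and \<epsilon> :: real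
  assumes "J \<ge> 1" and "v \<in> fe_space J" and "\<epsilon> > 0"
  shows "(LINT x:{0<..<1}|lborel.
            weak_dx v x / sqrt (\<bar>weak_dx v x\<bar>\<^sup>2 + \<epsilon>\<^sup>2)
              * weak_dx (\<lambda>y. - discrete_laplacian J v y) x) \<ge> 0"
  using mono_flux_discrete_laplacian_nonneg[OF assms(1,2) mono_regularised_sign[OF assms(3)]] .

end
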